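(* In the setting described in the context (in particular on a connected mesh with common material sum $c>0$), suppose in addition that the physical identity potential $\iota(X)=X$ belongs to $\mathcal Z_h$, and assume gradient-sampling unisolvence: for every $z\in\mathcal Z_h$ and every cell $e$, if $D_\xi(z_e-2cX_e)$ vanishes at all selected points $\xi_{eq}$ of that cell, then $D_\xi(z_e-2cX_e)$ vanishes identically on $\widehat K_e$. Then $$\max_{z\in\mathcal Z_h^0}\gamma_h(z)=c\quad\Longleftrightarrow\quad \iota\in\mathcal Z_h^0 ,$$ and every $z\in\mathcal Z_h^0$ with $\gamma_h(z)=c$ equals $2c\,\iota+b$ for some constant vector $b\in\mathbb R^3$.
   Context: Matrices: $A:B=\operatorname{tr}(A^TB)$; $\operatorname{cof}A$ is the matrix of signed $2\times2$ minors; $A\times B=\operatorname{cof}(A+B)-\operatorname{cof}A-\operatorname{cof}B$ for $A,B\in\mathbb R^{3\times3}$. Mesh: $\Omega_h\subset\mathbb R^3$ is a connected bounded Lipschitz domain partitioned into finitely many conforming cells $K_e=X_e(\widehat K_e)$, where each $X_e$ is an orientation-preserving one-to-one map of a fixed parent cell $\widehat K_e$ with bounded first derivatives and bounded inverse derivatives, the maps agreeing on shared faces. $J_{X,e}=D_\xi X_e$ ($D_\xi$: parent derivative, rows are vector components). For each cell a finite nonempty set of quadrature points $\xi_{eq}\in\widehat K_e$ with weights $w_{eq}$ is fixed, and $\mathcal L_e[f]=\sum_q w_{eq}f(\xi_{eq})-\int_{\widehat K_e}f\,d\xi$. $\widehat V_e$ is a fixed space of vector fields on $\widehat K_e$ (local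 variations, no boundary condition). $\mathcal Z_h$ is a fixed finite-dimensional linear space of continuous, piecewise differentiable vector fields $z:\Omega_h\to\mathbb R^3$ containing the constant vectors, with no prescribed trace; $z_e=z\circ X_e$. The physical gradient at a quadrature point, evaluated from cell $e$, is $R_z(X_e(\xi))=D_\xi z_e(\xi)\,J_{X,e}(\xi)^{-1}$. Put $\mathcal T_e(z_e;u,v)=\mathcal L_e[D_\xi z_e:(D_\xi u\times D_\xi v)]$ and $$\mathcal Z_h^0=\{z\in\mathcal Z_h:\mathcal T_e(z_e;u,v)=0\ \text{for every }e\text{ and all }u,v\in\widehat V_e\}.$$ Material: on each cell, $W_{\mathrm{iso},e}(F)=c_{1,e}(J^{-2/3}F:F-3)+c_{2,e}(J^{-4/3}\operatorname{cof}F:\operatorname{cof}F-3)$ with $J=\det F>0$, $c_{1,e},c_{2,e}\ge0$, and $c_{1,e}+c_{2,e}=c>0$ the same for all cells. Its Hessian at the identity, $\mathcal H_c=D^2W_{\mathrm{iso},e}(I_3)$, is independent of $e$. Put $\mathcal A[H,L]=2H:L+\tfrac23(\operatorname{tr}H)(\operatorname{tr}L)$. Margin: $\displaystyle\gamma_h(z)=\min_{e,q}\ \inf_{0\ne H\in\mathbb R^{3\times3}}\frac{\mathcal H_c[H,H]+R_z(X_e(\xi_{eq})):(H\times H)}{\mathcal A[H,H]}$. (The maximum of $\gamma_h$ over $\mathcal Z_h^0$ exists.) *)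

theory Defs
  imports "HOL-Analysis.Analysis"
begin

section \<open>Matrix algebra\<close>

definition mdot :: "real^3^3 \<Rightarrow> real^3^3 \<Rightarrow> real" where
  "mdot A B = trace (transpose A ** B)"

text \<open>Indices of type \<^typ>\<open>3\<close> are added modulo 3. Taking the two remaining rows and columns in
  cyclic order absorbs the checkerboard sign of the \<open>2 \<times> 2\<close> minors.\<close>

definition cof :: "real^3^3 \<Rightarrow> real^3^3" where
  "cof A = (\<chi> i j. A $ (i + 1) $ (j + 1) * A $ (i + 2) $ (j + 2)
                 - A $ (i + 1) $ (j + 2) * A $ (i + 2) $ (j + 1))"

definition mcross :: "real^3^3 \<Rightarrow> real^3^3 \<Rightarrow> real^3^3" where
  "mcross A B = cof (A + B) - cof A - cof B"


section \<open>Material\<close>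

text \<open>The energy is only meaningful where \<open>det F > 0\<close>; it is differentiated only at the identity,
  in a neighbourhood of which this holds.\<close>

definition W_iso :: "real \<Rightarrow> real \<Rightarrow> real^3^3 \<Rightarrow> real" where
  "W_iso c1 c2 F =
     c1 * (det F powr (-2/3) * mdot F F - 3) +
     c2 * (det F powr (-4/3) * mdot (cof F) (cof F) - 3)"

definition second_derivative ::
    "('a::real_normed_vector \<Rightarrow> real) \<Rightarrow> 'a \<Rightarrow> 'a \<Rightarrow> 'a \<Rightarrow> real" where
  "second_derivative W F H L =
     frechet_derivative (\<lambda>G. frechet_derivative W (at G) H) (at F) L"

definition iso_hessian :: "real \<Rightarrow> real \<Rightarrow> real^3^3 \<Rightarrow> real^3^3 \<Rightarrow> real" where
  "iso_hessian c1 c2 H L = second_derivative (W_iso c1 c2) (mat 1) H L"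

definition A_form :: "real^3^3 \<Rightarrow> real^3^3 \<Rightarrow> real" where
  "A_form H L = 2 * mdot H L + 2/3 * trace H * trace L"


section \<open>Meshes\<close>

text \<open>Near each boundary point the domain is the strict subgraph, in some direction \<open>n\<close>, of a
  Lipschitz function of the coordinates orthogonal to \<open>n\<close>.\<close>

definition lipschitz_domain :: "'a::euclidean_space set \<Rightarrow> bool" where
  "lipschitz_domain S \<longleftrightarrow> open S \<and>
     (\<forall>p\<in>frontier S. \<exists>n r L g. norm n = 1 \<and> r > 0 \<and> L-lipschitz_on {y. y \<bullet> n = 0} g \<and>
        (\<forall>x\<in>ball p r. x \<in> S \<longleftrightarrow> x \<bullet> n < g (x - (x \<bullet> n) *\<^sub>R n)))"

text \<open>Cells are labelled by \<open>'e\<close>; the quadrature points of each cell are labelled by \<open>'q\<close>.\<close>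

record ('e, 'q) fe_mesh =
  cells  :: "'e set"
  parent :: "'e \<Rightarrow> (real^3) set"
  chart  :: "'e \<Rightarrow> real^3 \<Rightarrow> real^3"
  qidx   :: "'e \<Rightarrow> 'q set"
  qpt    :: "'e \<Rightarrow> 'q \<Rightarrow> real^3"
  qwt    :: "'e \<Rightarrow> 'q \<Rightarrow> real"

definition cell :: "('e, 'q, 'm) fe_mesh_scheme \<Rightarrow> 'e \<Rightarrow> (real^3) set" where
  "cell M e = chart M e ` parent M e"

text \<open>Parent cells are closed, so derivatives are taken within the parent cell; this also covers
  quadrature points on its boundary. Row \<open>i\<close> of the matrix belongs to component \<open>i\<close> of the field.\<close>

definition Dpar :: "('e, 'q, 'm) fe_mesh_scheme \<Rightarrow> 'e \<Rightarrow> (real^3 \<Rightarrow> real^3) \<Rightarrow> real^3 \<Rightarrow> real^3^3" where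
  "Dpar M e u \<xi> = jacobian u (at \<xi> within parent M e)"

abbreviation chart_jacobian :: "('e, 'q, 'm) fe_mesh_scheme \<Rightarrow> 'e \<Rightarrow> real^3 \<Rightarrow> real^3^3" where
  "chart_jacobian M e \<equiv> Dpar M e (chart M e)"

text \<open>A parent cell is a full-dimensional convex polytope. The faces \<open>A\<close> and \<open>B\<close> below may be empty,
  which is the case of disjoint cells; \<open>\<phi>\<close> identifies the two parent copies of a shared face.\<close>

definition conforming_mesh :: "(real^3) set \<Rightarrow> ('e, 'q, 'm) fe_mesh_scheme \<Rightarrow> bool" where
  "conforming_mesh \<Omega> M \<longleftrightarrow>
     finite (cells M) \<and>
     closure \<Omega> = (\<Union>e\<in>cells M. cell M e) \<and>
     (\<forall>e\<in>cells M.
        polytope (parent M e) \<and> interior (parent M e) \<noteq> {} \<and>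
        inj_on (chart M e) (parent M e) \<and>
        chart M e differentiable_on parent M e \<and>
        (\<forall>\<xi>\<in>parent M e. det (chart_jacobian M e \<xi>) > 0) \<and>
        bounded (chart_jacobian M e ` parent M e) \<and>
        bounded ((\<lambda>\<xi>. matrix_inv (chart_jacobian M e \<xi>)) ` parent M e)) \<and>
     (\<forall>e\<in>cells M. \<forall>f\<in>cells M. e \<noteq> f \<longrightarrow>
        interior (cell M e) \<inter> interior (cell M f) = {} \<and>
        (\<exists>A B \<phi>. A face_of parent M e \<and> B face_of parent M f \<and>
           cell M e \<inter> cell M f = chart M e ` A \<and>
           bij_betw \<phi> A B \<and> (\<forall>\<xi>\<in>A. chart M e \<xi> = chart M f (\<phi> \<xi>))))"

definition quadrature_rule :: "('e, 'q, 'm) fe_mesh_scheme \<Rightarrow> bool" where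
  "quadrature_rule M \<longleftrightarrow>
     (\<forall>e\<in>cells M. finite (qidx M e) \<and> qidx M e \<noteq> {} \<and> (\<forall>q\<in>qidx M e. qpt M e q \<in> parent M e))"


section \<open>Function spaces\<close>

text \<open>Linear spaces of vector fields on a set \<open>D\<close>. A field is a total function of which only the
  values on \<open>D\<close> matter, so a space is closed under changing its members off \<open>D\<close>.\<close>

definition field_space_on :: "(real^3) set \<Rightarrow> (real^3 \<Rightarrow> real^3) set \<Rightarrow> bool" where
  "field_space_on D V \<longleftrightarrow>
     (\<lambda>x. 0) \<in> V \<and>
     (\<forall>u\<in>V. \<forall>v\<in>V. (\<lambda>x. u x + v x) \<in> V) \<and>
     (\<forall>u\<in>V. \<forall>a. (\<lambda>x. a *\<^sub>R u x) \<in> V) \<and>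
     (\<forall>u\<in>V. \<forall>v. (\<forall>x\<in>D. v x = u x) \<longrightarrow> v \<in> V)"

definition finite_dim_on :: "(real^3) set \<Rightarrow> (real^3 \<Rightarrow> real^3) set \<Rightarrow> bool" where
  "finite_dim_on D V \<longleftrightarrow>
     (\<exists>B. finite B \<and> B \<subseteq> V \<and> (\<forall>v\<in>V. \<exists>a. \<forall>x\<in>D. v x = (\<Sum>b\<in>B. a b *\<^sub>R b x)))"

definition local_variation_spaces ::
    "('e, 'q, 'm) fe_mesh_scheme \<Rightarrow> ('e \<Rightarrow> (real^3 \<Rightarrow> real^3) set) \<Rightarrow> bool" where
  "local_variation_spaces M V \<longleftrightarrow>
     (\<forall>e\<in>cells M. field_space_on (parent M e) (V e) \<and>
        (\<forall>u\<in>V e. u differentiable_on parent M e))"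

text \<open>Potentials live on the closed domain, the union of the closed cells, since they are pulled
  back to closed parent cells.\<close>

definition potential_space ::
    "(real^3) set \<Rightarrow> ('e, 'q, 'm) fe_mesh_scheme \<Rightarrow> (real^3 \<Rightarrow> real^3) set \<Rightarrow> bool" where
  "potential_space \<Omega> M Z \<longleftrightarrow>
     field_space_on (closure \<Omega>) Z \<and> finite_dim_on (closure \<Omega>) Z \<and>
     (\<forall>b. (\<lambda>x. b) \<in> Z) \<and>
     (\<forall>z\<in>Z. continuous_on (closure \<Omega>) z \<and>
        (\<forall>e\<in>cells M. (z \<circ> chart M e) differentiable_on parent M e))"


section \<open>Quadrature defect, admissible potentials and margin\<close>

text \<open>The integral has the value 0 on non-integrable integrands.\<close>

definition quad_defect :: "('e, 'q, 'm) fe_mesh_scheme \<Rightarrow> 'e \<Rightarrow> (real^3 \<Rightarrow> real) \<Rightarrow> real" where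
  "quad_defect M e f =
     (\<Sum>q\<in>qidx M e. qwt M e q * f (qpt M e q)) - (LINT \<xi>:parent M e|lebesgue. f \<xi>)"

definition T_form :: "('e, 'q, 'm) fe_mesh_scheme \<Rightarrow> 'e \<Rightarrow>
    (real^3 \<Rightarrow> real^3) \<Rightarrow> (real^3 \<Rightarrow> real^3) \<Rightarrow> (real^3 \<Rightarrow> real^3) \<Rightarrow> real" where
  "T_form M e y u v =
     quad_defect M e (\<lambda>\<xi>. mdot (Dpar M e y \<xi>) (mcross (Dpar M e u \<xi>) (Dpar M e v \<xi>)))"

definition admissible :: "('e, 'q, 'm) fe_mesh_scheme \<Rightarrow> ('e \<Rightarrow> (real^3 \<Rightarrow> real^3) set) \<Rightarrow>
    (real^3 \<Rightarrow> real^3) set \<Rightarrow> (real^3 \<Rightarrow> real^3) set" where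
  "admissible M V Z =
     {z \<in> Z. \<forall>e\<in>cells M. \<forall>u\<in>V e. \<forall>v\<in>V e. T_form M e (z \<circ> chart M e) u v = 0}"

text \<open>The physical gradient at \<open>chart M e \<xi>\<close>, evaluated from cell \<open>e\<close>.\<close>

definition phys_grad ::
    "('e, 'q, 'm) fe_mesh_scheme \<Rightarrow> 'e \<Rightarrow> (real^3 \<Rightarrow> real^3) \<Rightarrow> real^3 \<Rightarrow> real^3^3" where
  "phys_grad M e z \<xi> = Dpar M e (z \<circ> chart M e) \<xi> ** matrix_inv (chart_jacobian M e \<xi>)"

definition margin :: "('e, 'q, 'm) fe_mesh_scheme \<Rightarrow> ('e \<Rightarrow> real) \<Rightarrow> ('e \<Rightarrow> real) \<Rightarrow>
    (real^3 \<Rightarrow> real^3) \<Rightarrow> real" where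
  "margin M c1 c2 z =
     (MIN (e, q) \<in> Sigma (cells M) (qidx M).
        INF H \<in> - {0}.
          (iso_hessian (c1 e) (c2 e) H H + mdot (phys_grad M e z (qpt M e q)) (mcross H H))
          / A_form H H)"

end

theory Submission
  imports Defs
begin

text \<open>
  On the diagonal, \<open>\<H>\<^sub>c[H,H] = c (\<A>[H,H] - 2 I : (H \<times> H))\<close>. Hence the quotient in the margin is
  \<open>c + (R - 2cI) : (H \<times> H) / \<A>[H,H]\<close>. Matrices of rank one satisfy \<open>H \<times> H = 0\<close>, so the infimum is
  at most \<open>c\<close>; since \<open>H \<times> H\<close> takes both signs of every matrix unit, the infimum equals \<open>c\<close> only for
  \<open>R = 2cI\<close>. A potential \<open>z\<close> of margin \<open>c\<close> thus satisfies \<open>D(z\<^sub>e - 2cX\<^sub>e) = 0\<close> at all quadrature points,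
  by unisolvence on whole cells, so \<open>z - 2c\<iota>\<close> is continuous on the connected closed domain with
  finitely many values. Linearity of \<open>\<T>\<^sub>e\<close> in \<open>z\<close> transfers admissibility between \<open>z\<close> and \<open>\<iota>\<close>.
\<close>

section \<open>Cofactor algebra\<close>

lemma mdot_eq_inner: "mdot A B = A \<bullet> B"
  by (simp add: mdot_def trace_def matrix_matrix_mult_def transpose_def inner_vec_def sum_3)

text \<open>The simplifier evaluates \<open>2 + 2 :: 3\<close> to the numeral \<open>4\<close> without reducing it further.\<close>

lemma three_simps: "(4::3) = 1" "(5::3) = 2"
  by simp_all

lemma mcross_nth:
  "mcross A B $ i $ j =
     A $ (i + 1) $ (j + 1) * B $ (i + 2) $ (j + 2) + B $ (i + 1) $ (j + 1) * A $ (i + 2) $ (j + 2)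
   - A $ (i + 1) $ (j + 2) * B $ (i + 2) $ (j + 1) - B $ (i + 1) $ (j + 2) * A $ (i + 2) $ (j + 1)"
  by (simp add: mcross_def cof_def algebra_simps)

lemma mcross_commute: "mcross A B = mcross B A"
  by (simp add: mcross_def add.commute)

lemma bilinear_mcross: "bilinear mcross"
  unfolding bilinear_def
  by (auto intro!: linearI simp: vec_eq_iff mcross_nth algebra_simps)

lemma bounded_bilinear_mcross: "bounded_bilinear mcross"
  using bilinear_mcross by (simp add: bilinear_conv_bounded_bilinear)

text \<open>\<open>cof\<close> is a quadratic map and \<open>mcross\<close> is its polarization. In
  this form the product rule for bilinear maps applies to \<open>cof\<close>.\<close>

lemma cof_eq_mcross: "cof A = (1/2) *\<^sub>R mcross A A"
  by (simp add: vec_eq_iff mcross_nth cof_def algebra_simps)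

text \<open>The trilinear form \<open>A \<bullet> mcross B C\<close> is the full polarization of
  \<open>6 * det\<close>, hence symmetric in its three arguments.\<close>

lemma inner_mcross_cyclic: "A \<bullet> mcross B C = B \<bullet> mcross C A"
  by (simp add: inner_vec_def sum_3 mcross_nth three_simps algebra_simps)

text \<open>Adding the Laplace expansions along the three rows counts the determinant three
  times.\<close>

lemma det_eq_inner_cof: "det A = (1/3) * (cof A \<bullet> A)"
  by (simp add: det_3 cof_def inner_vec_def sum_3 three_simps algebra_simps)

lemma trace_eq_inner: "trace A = mat 1 \<bullet> (A :: real^3^3)"
  by (simp add: trace_def mat_def inner_vec_def sum_3)


section \<open>The Hessian at the identity\<close>

lemma has_derivative_cof:
  "(cof has_derivative mcross G) (at G within S)"
proof -
  have "((\<lambda>G. (1/2) *\<^sub>R mcross G G) has_derivative (\<lambda>H. (1/2) *\<^sub>R (mcross G H + mcross H G))) (at G within S)"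
    by (intro has_derivative_scaleR_right bounded_bilinear.FDERIV[OF bounded_bilinear_mcross] has_derivative_ident)
  moreover have "(1/2) *\<^sub>R (mcross G H + mcross H G) = mcross G H" for H
    by (simp add: mcross_commute[of H G] flip: scaleR_2)
  ultimately show ?thesis
    by (simp add: cof_eq_mcross[abs_def])
qed

text \<open>Jacobi's formula: by symmetry of the trilinear form the three factors of the cubic form
  \<open>det\<close> contribute equally, which cancels the 1/3.\<close>

lemma has_derivative_det:
  "((det :: real^3^3 \<Rightarrow> real) has_derivative (\<lambda>H. cof G \<bullet> H)) (at G within S)"
proof -
  have "((\<lambda>G. (1/3) * (cof G \<bullet> G)) has_derivative (\<lambda>H. (1/3) * (cof G \<bullet> H + mcross G H \<bullet> G))) (at G within S)"
    by (intro has_derivative_mult_right has_derivative_inner has_derivative_cof has_derivative_ident)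
  moreover have "mcross G H \<bullet> G = 2 * (cof G \<bullet> H)" for H
    using inner_mcross_cyclic[of G G H] inner_mcross_cyclic[of G H G]
    by (simp add: cof_eq_mcross inner_commute)
  ultimately show ?thesis
    by (simp add: det_eq_inner_cof[abs_def])
qed

lemma has_derivative_det_powr:
  fixes G :: "real^3^3"
  assumes "det G > 0"
  shows "((\<lambda>G. det G powr a) has_derivative (\<lambda>H. a * det G powr (a - 1) * (cof G \<bullet> H))) (at G)"
  using has_derivative_compose[OF has_derivative_det
      has_real_derivative_powr[OF assms, of a, unfolded has_field_derivative_def]]
  by simp

text \<open>Derivative of the energy at \<open>F\<close> in direction \<open>H\<close>, in closed
  form where \<open>det F > 0\<close>. With \<open>H\<close> fixed it can be differentiated once
  more in \<open>F\<close>.\<close>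

definition W_iso_deriv :: "real \<Rightarrow> real \<Rightarrow> real^3^3 \<Rightarrow> real^3^3 \<Rightarrow> real" where
  "W_iso_deriv c1 c2 F H =
     c1 * (det F powr (-2/3) * (2 * (F \<bullet> H)) - 2/3 * det F powr (-5/3) * (cof F \<bullet> H) * (F \<bullet> F)) +
     c2 * (det F powr (-4/3) * (2 * (cof F \<bullet> mcross F H))
             - 4/3 * det F powr (-7/3) * (cof F \<bullet> H) * (cof F \<bullet> cof F))"

lemma has_derivative_W_iso:
  assumes "det F > 0"
  shows "(W_iso c1 c2 has_derivative W_iso_deriv c1 c2 F) (at F)"
  unfolding W_iso_def[abs_def] mdot_eq_inner
  apply (rule has_derivative_eq_rhs)
   apply (rule has_derivative_add has_derivative_diff has_derivative_mult_right has_derivative_mult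
      has_derivative_inner has_derivative_const has_derivative_ident
      has_derivative_det_powr has_derivative_cof assms)+
  apply (rule ext)
  apply (simp add: W_iso_deriv_def inner_commute algebra_simps)
  done

lemma frechet_derivative_W_iso:
  "det F > 0 \<Longrightarrow> frechet_derivative (W_iso c1 c2) (at F) = W_iso_deriv c1 c2 F"
  by (metis has_derivative_W_iso frechet_derivative_at)

lemma cof_mat1: "cof (mat 1) = mat 1"
  by (simp add: vec_eq_iff forall_3 cof_def three_simps mat_def)

text \<open>At the identity both isochoric invariants have the same second-order form, so only the
  sum of the moduli survives.\<close>

lemma iso_hessian_diag:
  "iso_hessian c1 c2 H H = (c1 + c2) * (A_form H H - 2 * mdot (mat 1) (mcross H H))"
proof -
  let ?I = "mat 1 :: real^3^3"
  define s where "s = ?I \<bullet> mcross H H"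
  define t where "t = ?I \<bullet> H"
  have tI: "?I \<bullet> H = t" and tI': "H \<bullet> ?I = t"
    by (simp_all add: t_def inner_commute)
  have IH: "mcross ?I H \<bullet> H = s"
    unfolding s_def using inner_mcross_cyclic[of H ?I H] by (simp add: inner_commute)
  have II: "?I \<bullet> ?I = 3"
    by (simp add: inner_vec_def sum_3 mat_def)
  \<comment> \<open>\<open>mcross ?I H\<close> is \<open>t\<close> times the identity minus the
    transpose of \<open>H\<close>, which explains this value and the next.\<close>
  have IIH: "?I \<bullet> mcross ?I H = 2 * t"
    by (simp add: t_def inner_vec_def sum_3 mcross_nth three_simps mat_def)
  have IHIH: "mcross ?I H \<bullet> mcross ?I H = t^2 + H \<bullet> H"
    by (simp add: t_def inner_vec_def sum_3 mcross_nth three_simps mat_def power2_eq_square algebra_simps)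
  have detI: "det ?I > 0"
    by simp
  have op: "open {F :: real^3^3. det F > 0}"
    using has_derivative_continuous_on[OF has_derivative_det, of UNIV]
    by (intro open_Collect_less continuous_intros) auto
  \<comment> \<open>At the identity the determinant powers are 1, \<open>cof ?I = ?I\<close> and
    \<open>?I \<bullet> ?I = 3\<close>. The factors 5/3 and 7/3 come from differentiating the powers
    with exponents -5/3 and -7/3.\<close>
  have d: "((\<lambda>F. W_iso_deriv c1 c2 F H) has_derivative
          (\<lambda>K. c1 * (2 * (K \<bullet> H) - 2/3 * (?I \<bullet> K) * (2 * t)
                 - 2/3 * ((mcross ?I K \<bullet> H) * 3 + t * (2 * (?I \<bullet> K)) - 5/3 * (?I \<bullet> K) * t * 3)) +
               c2 * (2 * (?I \<bullet> mcross K H + mcross ?I K \<bullet> mcross ?I H) - 4/3 * (?I \<bullet> K) * (4 * t)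
                 - 4/3 * ((mcross ?I K \<bullet> H) * 3 + t * (2 * (?I \<bullet> mcross ?I K)) - 7/3 * (?I \<bullet> K) * t * 3))))
        (at ?I)" (is "(_ has_derivative ?D) _")
    unfolding W_iso_deriv_def
    apply (rule has_derivative_eq_rhs)
     apply (rule has_derivative_add has_derivative_diff has_derivative_mult_right has_derivative_mult
        has_derivative_inner has_derivative_const has_derivative_ident
        has_derivative_det_powr has_derivative_cof bounded_bilinear.FDERIV[OF bounded_bilinear_mcross] detI)+
    apply (rule ext)
    apply (simp add: cof_mat1 II IIH inner_commute tI tI' bounded_bilinear.zero_right[OF bounded_bilinear_mcross])
    apply (simp add: field_simps)
    done
  \<comment> \<open>The closed form of the first derivative is available where the determinant is
    positive, which is an open neighbourhood of the identity.\<close>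
  have d': "((\<lambda>F. frechet_derivative (W_iso c1 c2) (at F) H) has_derivative ?D) (at ?I)"
    by (rule has_derivative_transform_within_open[OF d op]) (simp_all add: frechet_derivative_W_iso)
  show ?thesis
    unfolding iso_hessian_def second_derivative_def
    apply (subst frechet_derivative_at[symmetric, OF d'])
    apply (simp_all add: IH IHIH IIH A_form_def mdot_eq_inner trace_eq_inner
        flip: s_def t_def)
    apply (simp add: field_simps power2_eq_square)
    done
qed


section \<open>The margin\<close>

lemma A_form_diag: "A_form H H = 2 * (norm H)\<^sup>2 + 2/3 * (trace H)\<^sup>2"
  by (simp add: A_form_def mdot_eq_inner power2_norm_eq_inner power2_eq_square[of "trace H"])

lemma A_form_pos: "H \<noteq> 0 \<Longrightarrow> A_form H H > 0"
  unfolding A_form_diag by (intro add_pos_nonneg) auto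

lemma margin_quotient:
  assumes "H \<noteq> 0"
  shows "(iso_hessian a b H H + mdot R (mcross H H)) / A_form H H
           = (a + b) + (R - (2 * (a + b)) *\<^sub>R mat 1) \<bullet> mcross H H / A_form H H"
proof -
  have "iso_hessian a b H H + mdot R (mcross H H)
      = (a + b) * A_form H H + (R - (2 * (a + b)) *\<^sub>R mat 1) \<bullet> mcross H H"
    by (simp add: iso_hessian_diag mdot_eq_inner inner_diff_left right_diff_distrib)
  then show ?thesis
    using A_form_pos[OF assms] by (simp add: add_divide_distrib)
qed

text \<open>A real infimum can be compared with its members only once a lower bound exists. Here the
  numerator is bounded by a multiple of the squared norm of \<open>H\<close>, which
  \<open>A_form H H\<close> dominates.\<close>

lemma mcross_quotient_bdd_below: "bdd_below ((\<lambda>H. a + S \<bullet> mcross H H / A_form H H) ` (- {0}))"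
proof -
  obtain K where K: "\<And>G H. norm (mcross G H) \<le> norm G * norm H * K" and K0: "K \<ge> 0"
    using bounded_bilinear.nonneg_bounded[OF bounded_bilinear_mcross] by blast
  have "a - norm S * K \<le> a + S \<bullet> mcross H H / A_form H H" if "H \<noteq> 0" for H
  proof -
    have "- (S \<bullet> mcross H H) \<le> norm S * (norm H * norm H * K)"
      using Cauchy_Schwarz_ineq2[of S "mcross H H"] mult_left_mono[OF K[of H H] norm_ge_zero[of S]]
      by linarith
    also have "\<dots> = norm S * K * (norm H)\<^sup>2"
      by (simp add: power2_eq_square)
    also have "\<dots> \<le> norm S * K * A_form H H"
      using K0 by (intro mult_left_mono) (auto simp: A_form_diag intro: add_increasing2)
    finally show ?thesis
      using A_form_pos[OF that] by (simp add: field_simps)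
  qed
  then show ?thesis
    by (intro bdd_belowI2[of _ "a - norm S * K"]) auto
qed

lemma inner_mcross_nonneg_imp_zero:
  assumes "\<And>H. S \<bullet> mcross H H \<ge> 0"
  shows "S = 0"
proof -
  have "S $ i $ j = 0" for i j
  proof -
    \<comment> \<open>The two nonzero entries lie in complementary rows and columns of
      \<open>(i, j)\<close>, so only the minor at \<open>(i, j)\<close> survives and
      \<open>mcross (H s) (H s)\<close> is \<open>2 * s\<close> times a matrix unit. Both signs of
      \<open>s\<close> are tested.\<close>
    define H :: "real \<Rightarrow> real^3^3" where
      "H s = (\<chi> k l. if k = i + 1 \<and> l = j + 1 then 1 else if k = i + 2 \<and> l = j + 2 then s else 0)" for s
    have "S \<bullet> mcross (H s) (H s) = 2 * s * S $ i $ j" for s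
      using exhaust_3[of i] exhaust_3[of j]
      by (elim disjE) (simp_all add: H_def inner_vec_def sum_3 mcross_nth three_simps)
    then show ?thesis
      using assms[of "H 1"] assms[of "H (-1)"] by simp
  qed
  then show ?thesis
    by (simp add: vec_eq_iff)
qed

text \<open>All 2 by 2 minors of a rank-one matrix vanish. Such a direction does not see
  \<open>R\<close>, which caps the infimum.\<close>

lemma ex_nonzero_mcross_eq_0: "\<exists>H. H \<noteq> 0 \<and> mcross H H = 0"
proof -
  let ?H = "(\<chi> k l. if k = 1 \<and> l = 1 then 1 else 0) :: real^3^3"
  have "?H $ 1 $ 1 \<noteq> 0"
    by simp
  then have "?H \<noteq> 0"
    by (metis zero_index)
  moreover have "mcross ?H ?H = 0"
    by (simp add: vec_eq_iff forall_3 mcross_nth three_simps)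
  ultimately show ?thesis
    by blast
qed

lemma INF_margin_quotient:
  fixes a b :: real and R :: "real^3^3"
  defines "m \<equiv> INF H \<in> - {0}. (iso_hessian a b H H + mdot R (mcross H H)) / A_form H H"
  shows INF_margin_quotient_le: "m \<le> a + b"
    and INF_margin_quotient_eq_iff: "m = a + b \<longleftrightarrow> R = (2 * (a + b)) *\<^sub>R mat 1"
proof -
  define S where "S = R - (2 * (a + b)) *\<^sub>R mat 1"
  have m: "m = (INF H \<in> - {0}. (a + b) + S \<bullet> mcross H H / A_form H H)"
    unfolding m_def S_def by (intro INF_cong refl margin_quotient) auto
  have lower: "m \<le> (a + b) + S \<bullet> mcross H H / A_form H H" if "H \<noteq> 0" for H
    unfolding m using that by (intro cINF_lower mcross_quotient_bdd_below) auto
  obtain H0 where H0: "H0 \<noteq> 0" "mcross H0 H0 = 0"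
    using ex_nonzero_mcross_eq_0 by blast
  show "m \<le> a + b"
    using lower[OF H0(1)] H0(2) by simp
  show "m = a + b \<longleftrightarrow> R = (2 * (a + b)) *\<^sub>R mat 1"
  proof
    assume eq: "m = a + b"
    have "S \<bullet> mcross H H \<ge> 0" for H
    proof (cases "H = 0")
      case True
      then show ?thesis
        by (simp add: bounded_bilinear.zero_right[OF bounded_bilinear_mcross])
    next
      case False
      then show ?thesis
        using lower[OF False] A_form_pos[OF False] eq by (simp add: zero_le_divide_iff)
    qed
    then have "S = 0"
      by (rule inner_mcross_nonneg_imp_zero)
    then show "R = (2 * (a + b)) *\<^sub>R mat 1"
      by (simp add: S_def)
  next
    assume "R = (2 * (a + b)) *\<^sub>R mat 1"
    then have "S = 0"
      by (simp add: S_def)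
    \<comment> \<open>The quotient is now constant; \<open>H0\<close> witnesses that there are
      nonzero matrices to take the infimum over.\<close>
    then show "m = a + b"
      using H0(1) by (auto simp: m intro!: cINF_const)
  qed
qed

text \<open>Every entry of the finite nonempty minimum is at most the common \<open>c\<close>, so
  the minimum reaches \<open>c\<close> only if all entries equal \<open>c\<close>.\<close>

lemma
  fixes M :: "('e, 'q) fe_mesh"
  assumes "finite (cells M)" "cells M \<noteq> {}" "quadrature_rule M"
    and "\<forall>e\<in>cells M. c1 e + c2 e = c"
  shows margin_le: "margin M c1 c2 z \<le> c"
    and margin_eq_iff: "margin M c1 c2 z = c \<longleftrightarrow>
       (\<forall>e\<in>cells M. \<forall>q\<in>qidx M e. phys_grad M e z (qpt M e q) = (2 * c) *\<^sub>R mat 1)"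
proof -
  define m where "m e q = (INF H \<in> - {0}.
    (iso_hessian (c1 e) (c2 e) H H + mdot (phys_grad M e z (qpt M e q)) (mcross H H)) / A_form H H)"
    for e q
  let ?P = "Sigma (cells M) (qidx M)"
  have fin: "finite ?P" and ne: "?P \<noteq> {}"
    using assms by (auto simp: quadrature_rule_def Sigma_empty_iff)
  have margin: "margin M c1 c2 z = Min ((\<lambda>(e, q). m e q) ` ?P)"
    by (simp add: margin_def m_def)
  have le: "m e q \<le> c" and eq: "m e q = c \<longleftrightarrow> phys_grad M e z (qpt M e q) = (2 * c) *\<^sub>R mat 1"
    if "e \<in> cells M" for e q
    using that assms(4) INF_margin_quotient[of "c1 e" "c2 e" "phys_grad M e z (qpt M e q)"]
    unfolding m_def by auto
  show *: "margin M c1 c2 z \<le> c"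
    using fin ne le by (auto simp: margin Min_le_iff)
  have "margin M c1 c2 z = c \<longleftrightarrow> c \<le> margin M c1 c2 z"
    using * by auto
  also have "\<dots> \<longleftrightarrow> (\<forall>e\<in>cells M. \<forall>q\<in>qidx M e. m e q \<ge> c)"
    using fin ne by (simp add: margin)
  also have "\<dots> \<longleftrightarrow> (\<forall>e\<in>cells M. \<forall>q\<in>qidx M e. m e q = c)"
    by (intro ball_cong refl) (auto intro: antisym le)
  finally show "margin M c1 c2 z = c \<longleftrightarrow>
       (\<forall>e\<in>cells M. \<forall>q\<in>qidx M e. phys_grad M e z (qpt M e q) = (2 * c) *\<^sub>R mat 1)"
    using eq by simp
qed


section \<open>Derivatives on parent cells\<close>

text \<open>Covers boundary points of parent cells. One-sided derivatives along segments from
  \<open>x\<close> to points of \<open>S\<close> fix the derivative on all \<open>p - x\<close>, and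
  these directions span because \<open>S\<close> has interior.\<close>

lemma has_derivative_within_convex_unique:
  fixes f :: "'a::real_normed_vector \<Rightarrow> 'b::real_normed_vector"
  assumes S: "convex S" "interior S \<noteq> {}" "x \<in> S"
    and f': "(f has_derivative f') (at x within S)"
    and f'': "(f has_derivative f'') (at x within S)"
  shows "f' = f''"
proof -
  have segment: "f' (p - x) = f'' (p - x)" if "p \<in> S" for p
  proof -
    let ?l = "\<lambda>t::real. x + t *\<^sub>R (p - x)"
    have l: "?l ` {0..1} \<subseteq> S"
      using S(1,3) that by (auto simp: convex_alt algebra_simps)
    have "((f \<circ> ?l) has_vector_derivative g (p - x)) (at 0 within {0..1})"
      if "(f has_derivative g) (at x within S)" for g
    proof -
      have "(?l has_vector_derivative (p - x)) (at 0 within {0..1})"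
        by (auto intro!: derivative_eq_intros)
      moreover have "(f has_derivative g) (at (?l 0) within ?l ` {0..1})"
        using that l by (auto intro: has_derivative_subset)
      ultimately show ?thesis
        by (rule vector_derivative_diff_chain_within)
    qed
    from this[OF f'] this[OF f''] show ?thesis
      by (intro vector_derivative_unique_within[of 0 "{0..1}"]) 
         (auto simp: trivial_limit_within islimpt_Icc)
  qed
  interpret f': bounded_linear f' using f' by (rule has_derivative_bounded_linear)
  interpret f'': bounded_linear f'' using f'' by (rule has_derivative_bounded_linear)
  obtain p r where r: "r > 0" and ball: "ball p r \<subseteq> S"
    using S(2) by (auto simp: mem_interior)
  have "f' v = f'' v" for v
  proof (cases "v = 0")
    case False
    \<comment> \<open>Both \<open>p\<close> and \<open>p + s *\<^sub>R v\<close> lie in the ball, so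
      \<open>s *\<^sub>R v\<close> is a difference of two directions already settled.\<close>
    define s where "s = r / (2 * norm v)"
    have s: "s > 0" and "p + s *\<^sub>R v \<in> ball p r"
      using r False by (auto simp: s_def dist_norm)
    have "f' (p + s *\<^sub>R v - x) = f'' (p + s *\<^sub>R v - x)" "f' (p - x) = f'' (p - x)"
      using \<open>p + s *\<^sub>R v \<in> ball p r\<close> ball r by (auto intro!: segment)
    moreover have "f' (p + s *\<^sub>R v - x) = f' (p - x) + s *\<^sub>R f' v"
      "f'' (p + s *\<^sub>R v - x) = f'' (p - x) + s *\<^sub>R f'' v"
      by (simp_all add: f'.add f''.add f'.diff f''.diff f'.scaleR f''.scaleR)
    ultimately have "s *\<^sub>R f' v = s *\<^sub>R f'' v"
      by simp
    then show ?thesis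
      using s by simp
  qed (simp add: f'.zero f''.zero)
  then show ?thesis ..
qed

lemma has_derivative_Dpar:
  assumes "u differentiable_on parent M e" "\<xi> \<in> parent M e"
  shows "(u has_derivative (\<lambda>h. Dpar M e u \<xi> *v h)) (at \<xi> within parent M e)"
  using assms unfolding Dpar_def differentiable_on_def by (metis jacobian_works)

text \<open>\<open>Dpar\<close> rests on a chosen derivative; uniqueness within the convex cell
  identifies it with any derivative found by calculation.\<close>

lemma Dpar_eqI:
  assumes "convex (parent M e)" "interior (parent M e) \<noteq> {}" "\<xi> \<in> parent M e"
    and der: "(u has_derivative (\<lambda>h. A *v h)) (at \<xi> within parent M e)"
  shows "Dpar M e u \<xi> = A"
proof -
  have "(u has_derivative (\<lambda>h. Dpar M e u \<xi> *v h)) (at \<xi> within parent M e)"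
    using der unfolding Dpar_def by (metis differentiableI jacobian_works)
  then have "(\<lambda>h. Dpar M e u \<xi> *v h) = (\<lambda>h. A *v h)"
    using has_derivative_within_convex_unique assms by blast
  then show ?thesis
    by (simp add: matrix_eq fun_eq_iff)
qed

lemma Dpar_diff_scaleR:
  assumes "convex (parent M e)" "interior (parent M e) \<noteq> {}"
    and "u differentiable_on parent M e" "v differentiable_on parent M e" and \<xi>: "\<xi> \<in> parent M e"
  shows "Dpar M e (\<lambda>\<xi>. u \<xi> - a *\<^sub>R v \<xi>) \<xi> = Dpar M e u \<xi> - a *\<^sub>R Dpar M e v \<xi>"
proof (rule Dpar_eqI[OF assms(1,2) \<xi>])
  show "((\<lambda>\<xi>. u \<xi> - a *\<^sub>R v \<xi>) has_derivative (*v) (Dpar M e u \<xi> - a *\<^sub>R Dpar M e v \<xi>))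
          (at \<xi> within parent M e)"
    using assms by (auto intro!: derivative_eq_intros has_derivative_Dpar
        simp: matrix_vector_mult_diff_rdistrib scaleR_matrix_vector_assoc)
qed

text \<open>Only homogeneity is used: the value 0 for non-integrable integrands is compatible with
  scaling, whereas additivity would require integrability.\<close>

lemma T_form_scaleR:
  assumes "quadrature_rule M" "e \<in> cells M"
    and D: "\<And>\<xi>. \<xi> \<in> parent M e \<Longrightarrow> Dpar M e y \<xi> = a *\<^sub>R Dpar M e y' \<xi>"
  shows "T_form M e y u v = a * T_form M e y' u v"
proof -
  let ?X = "\<lambda>\<xi>. mcross (Dpar M e u \<xi>) (Dpar M e v \<xi>)"
  have scale: "mdot (a *\<^sub>R A) B = a * mdot A B" for A B
    by (simp add: mdot_eq_inner)
  have "(\<Sum>q\<in>qidx M e. qwt M e q * mdot (Dpar M e y (qpt M e q)) (?X (qpt M e q)))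
      = a * (\<Sum>q\<in>qidx M e. qwt M e q * mdot (Dpar M e y' (qpt M e q)) (?X (qpt M e q)))"
    unfolding sum_distrib_left using assms(1,2)
    by (intro sum.cong) (auto simp: D scale quadrature_rule_def)
  moreover have "(LINT \<xi>:parent M e|lebesgue. mdot (Dpar M e y \<xi>) (?X \<xi>))
      = (LINT \<xi>:parent M e|lebesgue. a * mdot (Dpar M e y' \<xi>) (?X \<xi>))"
    unfolding set_lebesgue_integral_def
    by (intro Bochner_Integration.integral_cong refl) (auto simp: D scale indicator_def)
  ultimately show ?thesis
    by (simp add: T_form_def quad_defect_def algebra_simps)
qed

section \<open>Physical gradients and chart Jacobians\<close>

lemma conforming_meshD:
  assumes "conforming_mesh \<Omega> M" "e \<in> cells M"
  shows "convex (parent M e)" "interior (parent M e) \<noteq> {}" "chart M e differentiable_on parent M e"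
    "\<xi> \<in> parent M e \<Longrightarrow> invertible (chart_jacobian M e \<xi>)"
  using assms unfolding conforming_mesh_def
  by (force simp: polytope_imp_convex invertible_det_nz)+

lemma matrix_inv_inverse:
  assumes "invertible A"
  shows "A ** matrix_inv A = mat 1" "matrix_inv A ** A = mat 1"
  using someI_ex[OF assms[unfolded invertible_def]] by (simp_all add: matrix_inv_def)

text \<open>Multiplying by the invertible chart Jacobian turns the equality case of the margin into
  the vanishing condition of unisolvence.\<close>

lemma phys_grad_eq_iff:
  assumes mesh: "conforming_mesh \<Omega> M" and e: "e \<in> cells M" and \<xi>: "\<xi> \<in> parent M e"
    and z: "(z \<circ> chart M e) differentiable_on parent M e"
  shows "phys_grad M e z \<xi> = a *\<^sub>R mat 1 \<longleftrightarrow> 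
         Dpar M e (\<lambda>\<xi>. z (chart M e \<xi>) - a *\<^sub>R chart M e \<xi>) \<xi> = 0"
proof -
  note mD = conforming_meshD[OF mesh e]
  let ?J = "chart_jacobian M e \<xi>" and ?D = "Dpar M e (z \<circ> chart M e) \<xi>"
  note inv = mD(4)[OF \<xi>]
  have "?D ** matrix_inv ?J = a *\<^sub>R mat 1 \<longleftrightarrow> ?D = a *\<^sub>R ?J"
  proof
    assume "?D ** matrix_inv ?J = a *\<^sub>R mat 1"
    then have "?D ** matrix_inv ?J ** ?J = a *\<^sub>R mat 1 ** ?J"
      by simp
    then show "?D = a *\<^sub>R ?J"
      by (simp add: matrix_inv_inverse[OF inv] flip: matrix_mul_assoc scalar_matrix_assoc)
  next
    assume "?D = a *\<^sub>R ?J"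
    then show "?D ** matrix_inv ?J = a *\<^sub>R mat 1"
      by (simp add: matrix_inv_inverse[OF inv] flip: scalar_matrix_assoc)
  qed
  moreover have "Dpar M e (\<lambda>\<xi>. z (chart M e \<xi>) - a *\<^sub>R chart M e \<xi>) \<xi> = ?D - a *\<^sub>R ?J"
    using Dpar_diff_scaleR[OF mD(1,2) z mD(3) \<xi>] by (simp add: o_def)
  ultimately show ?thesis
    by (simp add: phys_grad_def)
qed

section \<open>From vanishing derivatives to a global constant\<close>

lemma Dpar_zero_imp_constant:
  assumes "convex (parent M e)" "u differentiable_on parent M e"
    and "\<And>\<xi>. \<xi> \<in> parent M e \<Longrightarrow> Dpar M e u \<xi> = 0"
  shows "u constant_on parent M e"
proof -
  have "(u has_derivative (\<lambda>h. 0)) (at \<xi> within parent M e)" if "\<xi> \<in> parent M e" for \<xi>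
    using has_derivative_Dpar[OF assms(2) that] assms(3)[OF that] by simp
  then show ?thesis
    unfolding constant_on_def by (rule has_derivative_zero_constant[OF assms(1)])
qed

text \<open>The image of \<open>S\<close> is connected and finite, hence at most one point. This
  replaces passing from cell to cell through shared faces.\<close>

lemma continuous_constant_on_finite_cover:
  fixes w :: "'a::topological_space \<Rightarrow> 'b::metric_space"
  assumes "connected S" "continuous_on S w" "finite I" "S = (\<Union>i\<in>I. C i)"
    and "\<And>i. i \<in> I \<Longrightarrow> w constant_on C i"
  shows "w constant_on S"
proof -
  obtain b where b: "\<And>i x. i \<in> I \<Longrightarrow> x \<in> C i \<Longrightarrow> w x = b i"
    using assms(5) unfolding constant_on_def by metis
  then have "w ` S \<subseteq> b ` I"
    using assms(4) by auto
  then have "finite (w ` S)"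
    using assms(3) finite_surj by blast
  moreover have "connected (w ` S)"
    using assms(1,2) by (rule connected_continuous_image[rotated])
  ultimately have "w ` S = {} \<or> (\<exists>a. w ` S = {a})"
    by (simp add: connected_finite_iff_sing)
  then show ?thesis
    unfolding constant_on_def by blast
qed

section \<open>Equality case of the margin and rigidity of maximizers\<close>

theorem corollary8:
  fixes \<Omega> :: "(real^3) set"
    and M :: "('e, 'q) fe_mesh"
    and V :: "'e \<Rightarrow> (real^3 \<Rightarrow> real^3) set"
    and Z :: "(real^3 \<Rightarrow> real^3) set"
    and c1 c2 :: "'e \<Rightarrow> real"
    and c :: real
  assumes domain: "lipschitz_domain \<Omega>" "\<Omega> \<noteq> {}" "connected \<Omega>" "bounded \<Omega>"
    and mesh: "conforming_mesh \<Omega> M"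
    and quadrature: "quadrature_rule M"
    and variations: "local_variation_spaces M V"
    and potentials: "potential_space \<Omega> M Z"
    and material: "\<forall>e\<in>cells M. c1 e \<ge> 0 \<and> c2 e \<ge> 0 \<and> c1 e + c2 e = c"
    and c_pos: "c > 0"
    and identity: "(\<lambda>x. x) \<in> Z"
    and unisolvence: "\<forall>z\<in>Z. \<forall>e\<in>cells M.
          (\<forall>q\<in>qidx M e. Dpar M e (\<lambda>\<xi>. z (chart M e \<xi>) - (2 * c) *\<^sub>R chart M e \<xi>) (qpt M e q) = 0) \<longrightarrow>
          (\<forall>\<xi>\<in>parent M e. Dpar M e (\<lambda>\<xi>. z (chart M e \<xi>) - (2 * c) *\<^sub>R chart M e \<xi>) \<xi> = 0)"
  shows "((\<exists>z\<in>admissible M V Z. margin M c1 c2 z = c) \<and> (\<forall>z\<in>admissible M V Z. margin M c1 c2 z \<le> c)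
            \<longleftrightarrow> (\<lambda>x. x) \<in> admissible M V Z) \<and>
         (\<forall>z\<in>admissible M V Z. margin M c1 c2 z = c \<longrightarrow>
            (\<exists>b. \<forall>x\<in>closure \<Omega>. z x = (2 * c) *\<^sub>R x + b))"
proof -
  note mD = conforming_meshD[OF mesh]
  have fin: "finite (cells M)" and cover: "closure \<Omega> = (\<Union>e\<in>cells M. cell M e)"
    using mesh by (auto simp: conforming_mesh_def)
  have ne: "cells M \<noteq> {}"
    using cover domain(2) by auto
  have space: "field_space_on (closure \<Omega>) Z"
    and cont: "\<And>z. z \<in> Z \<Longrightarrow> continuous_on (closure \<Omega>) z"
    and diff: "\<And>z e. z \<in> Z \<Longrightarrow> e \<in> cells M \<Longrightarrow> (z \<circ> chart M e) differentiable_on parent M e"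
    using potentials by (auto simp: potential_space_def)
  have qpt: "\<And>e q. e \<in> cells M \<Longrightarrow> q \<in> qidx M e \<Longrightarrow> qpt M e q \<in> parent M e"
    using quadrature by (auto simp: quadrature_rule_def)
  have sum_c: "\<forall>e\<in>cells M. c1 e + c2 e = c"
    using material by auto
  let ?w = "\<lambda>z e \<xi>. z (chart M e \<xi>) - (2 * c) *\<^sub>R chart M e \<xi>"
  have le: "margin M c1 c2 z \<le> c" for z
    by (rule margin_le[OF fin ne quadrature sum_c])
  have eq_iff: "margin M c1 c2 z = c \<longleftrightarrow> (\<forall>e\<in>cells M. \<forall>q\<in>qidx M e. Dpar M e (?w z e) (qpt M e q) = 0)"
    if "z \<in> Z" for z
    using phys_grad_eq_iff[OF mesh _ qpt diff[OF that]]
    by (simp add: margin_eq_iff[OF fin ne quadrature sum_c])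
  have Dpar_w: "Dpar M e (?w z e) \<xi> = Dpar M e (z \<circ> chart M e) \<xi> - (2 * c) *\<^sub>R chart_jacobian M e \<xi>"
    if "z \<in> Z" "e \<in> cells M" "\<xi> \<in> parent M e" for z e \<xi>
    using Dpar_diff_scaleR[OF mD(1,2) diff mD(3)] that by (simp add: o_def)

  have rigid: "\<forall>\<xi>\<in>parent M e. Dpar M e (?w z e) \<xi> = 0"
    if "z \<in> Z" "margin M c1 c2 z = c" "e \<in> cells M" for z e
    using unisolvence eq_iff[OF that(1)] that by blast

  have unique: "\<exists>b. \<forall>x\<in>closure \<Omega>. z x = (2 * c) *\<^sub>R x + b"
    if z: "z \<in> Z" and max: "margin M c1 c2 z = c" for z
  proof -
    let ?v = "\<lambda>x. z x - (2 * c) *\<^sub>R x"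
    have "?v constant_on cell M e" if e: "e \<in> cells M" for e
    proof -
      have "?w z e differentiable_on parent M e"
        using diff[OF z e] mD(3)[OF e] by (auto simp: o_def differentiable_on_def intro!: derivative_intros)
      then have "?w z e constant_on parent M e"
        using mD(1)[OF e] rigid[OF z max e] by (intro Dpar_zero_imp_constant) auto
      then show ?thesis
        by (auto simp: constant_on_def cell_def)
    qed
    \<comment> \<open>Continuity across cells forces the constants of the individual cells to
      agree.\<close>
    moreover have "continuous_on (closure \<Omega>) ?v"
      by (intro continuous_intros cont z)
    ultimately have "?v constant_on closure \<Omega>"
      by (intro continuous_constant_on_finite_cover[OF connected_imp_connected_closure[OF domain(3)] _ fin cover])
    then show ?thesis
      unfolding constant_on_def by (metis add.commute diff_add_cancel)
  qed

  have identity_admissible: "(\<lambda>x. x) \<in> admissible M V Z"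
    if z: "z \<in> admissible M V Z" and max: "margin M c1 c2 z = c" for z
  proof -
    have zZ: "z \<in> Z"
      using z by (simp add: admissible_def)
    have "T_form M e (chart M e) u v = 0" if e: "e \<in> cells M" and "u \<in> V e" "v \<in> V e" for e u v
    proof -
      have "Dpar M e (z \<circ> chart M e) \<xi> = (2 * c) *\<^sub>R chart_jacobian M e \<xi>" if "\<xi> \<in> parent M e" for \<xi>
        using rigid[OF zZ max e] Dpar_w[OF zZ e] that by simp
      then have "T_form M e (z \<circ> chart M e) u v = 2 * c * T_form M e (chart M e) u v"
        by (rule T_form_scaleR[OF quadrature e])
      moreover have "T_form M e (z \<circ> chart M e) u v = 0"
        using z that by (auto simp: admissible_def)
      \<comment> \<open>Positivity of \<open>c\<close> permits cancelling the factor
        \<open>2 * c\<close>.\<close>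
      ultimately show ?thesis
        using c_pos by simp
    qed
    then show ?thesis
      using identity by (simp add: admissible_def o_def)
  qed

  have attained: "\<exists>z\<in>admissible M V Z. margin M c1 c2 z = c"
    if id: "(\<lambda>x. x) \<in> admissible M V Z"
  proof
    \<comment> \<open>The candidate has physical gradient \<open>2 * c\<close> times the identity,
      exactly the equality case of the margin.\<close>
    let ?z = "\<lambda>x :: real^3. (2 * c) *\<^sub>R x"
    have zZ: "?z \<in> Z"
    proof -
      have "\<forall>u\<in>Z. \<forall>a. (\<lambda>x. a *\<^sub>R u x) \<in> Z"
        using space by (simp add: field_space_on_def)
      from this[rule_format, OF identity, of "2 * c"] show ?thesis .
    qed
    have zero: "Dpar M e (?w ?z e) \<xi> = 0" if "e \<in> cells M" "\<xi> \<in> parent M e" for e \<xi>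
      using that mD by (auto intro!: Dpar_eqI)
    then show "margin M c1 c2 ?z = c"
      using qpt by (simp add: eq_iff[OF zZ])
    have "T_form M e (?z \<circ> chart M e) u v = 0" if e: "e \<in> cells M" and uv: "u \<in> V e" "v \<in> V e" for e u v
    proof -
      have "T_form M e (?z \<circ> chart M e) u v = 2 * c * T_form M e (chart M e) u v"
        \<comment> \<open>The vanishing of the derivative of \<open>?w\<close> is read back as
          proportionality to the chart Jacobian.\<close>
        using zero[OF e] Dpar_w[OF zZ e] by (intro T_form_scaleR[OF quadrature e]) simp
      also have "T_form M e (chart M e) u v = 0"
        using id that by (auto simp: admissible_def o_def)
      finally show ?thesis
        by (simp only: mult_zero_right)
    qed
    then show "?z \<in> admissible M V Z"
      using zZ by (simp add: admissible_def o_def)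
  qed

  show ?thesis
    using le unique identity_admissible attained by (auto simp: admissible_def)
qed

end
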